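(* Let $G$ be a finite group. Let $S$ be an $(s+t,s,s-\lambda)$-difference set in $G$. Suppose that $G$ does not admit a reversible $(s+t,s,s-\lambda)$-difference set. Then $(S,G\setminus S^{(-1)})$ is an $(s,t)$-$\lambda$-fold near-factorization of $G$ that is not equivalent to any symmetric near-factorization.
   Context: Subsets of $G$ are identified with the sums of their elements in the group ring $\mathbb{Z}[G]$; $e$ is the identity of $G$; for a subset $D$, $D^{(-1)}=\{d^{-1}:d\in D\}$. A $(v,k,\lambda)$-difference set in a group $G$ of order $v$ is a subset $D\subseteq G$ with $|D|=k$ and $DD^{(-1)}=k\cdot e+\lambda(G-e)$ in $\mathbb{Z}[G]$. It is reversible if $D=D^{(-1)}$. For $S,T\subseteq G$ and a positive integer $\lambda$, $(S,T)$ is an $(s,t)$-$\lambda$-fold near-factorization of $G$ if $|S|=s$, $|T|=t$ and $ST=\lambda(G-e)$ in $\mathbb{Z}[G]$. It is symmetric if $S=S^{(-1)}$ and $T=T^{(-1)}$. Two subsets $A,B\subseteq G$ are equivalent if there exist $f\in\mathrm{Aut}(G)$ and $g\in G$ with $B=gf(A)$ (this is the same relation as the existence of $f\in\mathrm{Aut}(G)$, $g\in G$ with $B=f(A)g$). Two $(s,t)$-$\lambda$-fold near-factorizations $(S,T)$ and $(S',T')$ of $G$ are equivalent if $S$ is equivalent to $S'$ and $T$ is equivalent to $T'$. *)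

theory Defs
  imports "HOL-Algebra.Bij" "HOL-Algebra.Coset" "HOL-Algebra.Ring"
begin

text \<open>
  The integral group ring of a finite group \<open>G\<close>: integer-valued functions on \<open>carrier G\<close>
  (extended by \<open>0\<close>), pointwise addition, and convolution as multiplication.  No finite-support
  condition is imposed, so this is the group ring only when \<open>carrier G\<close> is finite.
\<close>

definition group_ring :: "('a, 'b) monoid_scheme \<Rightarrow> ('a \<Rightarrow> int) ring" where
  "group_ring G =
    \<lparr>carrier = {a. \<forall>x. x \<notin> carrier G \<longrightarrow> a x = 0},
     mult = (\<lambda>a b g. if g \<in> carrier G
                      then \<Sum>x\<in>carrier G. a x * b (inv\<^bsub>G\<^esub> x \<otimes>\<^bsub>G\<^esub> g) else 0),
     one = (\<lambda>g. of_bool (g = \<one>\<^bsub>G\<^esub>)),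
     zero = (\<lambda>g. 0),
     add = (\<lambda>a b g. a g + b g)\<rparr>"

text \<open>The formal sum of the elements of \<open>A\<close>; its coefficients are those of the indicator function.\<close>

definition set_sum :: "'a set \<Rightarrow> 'a \<Rightarrow> int" where
  "set_sum A = (\<lambda>g. of_bool (g \<in> A))"

text \<open>
  The parameter \<open>l\<close> is an integer, so that parameters such as \<open>s - l\<close> can be written without
  truncated subtraction.
\<close>

definition difference_set ::
  "('a, 'b) monoid_scheme \<Rightarrow> nat \<Rightarrow> nat \<Rightarrow> int \<Rightarrow> 'a set \<Rightarrow> bool" where
  "difference_set G v k l D \<longleftrightarrow>
     order G = v \<and> D \<subseteq> carrier G \<and> card D = k \<and>
     set_sum D \<otimes>\<^bsub>group_ring G\<^esub> set_sum (set_inv\<^bsub>G\<^esub> D) =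
       [k] \<cdot>\<^bsub>group_ring G\<^esub> set_sum {\<one>\<^bsub>G\<^esub>} \<oplus>\<^bsub>group_ring G\<^esub>
       [l] \<cdot>\<^bsub>group_ring G\<^esub> (set_sum (carrier G) \<ominus>\<^bsub>group_ring G\<^esub> set_sum {\<one>\<^bsub>G\<^esub>})"

definition reversible :: "('a, 'b) monoid_scheme \<Rightarrow> 'a set \<Rightarrow> bool" where
  "reversible G D \<longleftrightarrow> D = set_inv\<^bsub>G\<^esub> D"

definition near_factorization ::
  "('a, 'b) monoid_scheme \<Rightarrow> nat \<Rightarrow> nat \<Rightarrow> nat \<Rightarrow> 'a set \<times> 'a set \<Rightarrow> bool" where
  "near_factorization G s t l = (\<lambda>(S, T).
     0 < l \<and> S \<subseteq> carrier G \<and> T \<subseteq> carrier G \<and> card S = s \<and> card T = t \<and>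
     set_sum S \<otimes>\<^bsub>group_ring G\<^esub> set_sum T =
       [l] \<cdot>\<^bsub>group_ring G\<^esub> (set_sum (carrier G) \<ominus>\<^bsub>group_ring G\<^esub> set_sum {\<one>\<^bsub>G\<^esub>}))"

definition symmetric_pair :: "('a, 'b) monoid_scheme \<Rightarrow> 'a set \<times> 'a set \<Rightarrow> bool" where
  "symmetric_pair G = (\<lambda>(S, T). S = set_inv\<^bsub>G\<^esub> S \<and> T = set_inv\<^bsub>G\<^esub> T)"

definition set_equivalent :: "('a, 'b) monoid_scheme \<Rightarrow> 'a set \<Rightarrow> 'a set \<Rightarrow> bool" where
  "set_equivalent G A B \<longleftrightarrow> (\<exists>f\<in>auto G. \<exists>g\<in>carrier G. B = g <#\<^bsub>G\<^esub> (f ` A))"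

definition pair_equivalent ::
  "('a, 'b) monoid_scheme \<Rightarrow> 'a set \<times> 'a set \<Rightarrow> 'a set \<times> 'a set \<Rightarrow> bool" where
  "pair_equivalent G = (\<lambda>(S, T) (S', T'). set_equivalent G S S' \<and> set_equivalent G T T')"

lemma set_sum_closed: "A \<subseteq> carrier G \<Longrightarrow> set_sum A \<in> carrier (group_ring G)"
  by (auto simp: group_ring_def set_sum_def)

lemma (in group) sum_translate:
  assumes "x \<in> carrier G"
  shows "(\<Sum>y\<in>carrier G. f (x \<otimes> y)) = sum f (carrier G)"
  by (rule sum.reindex_bij_witness[where i = "\<lambda>y. inv x \<otimes> y" and j = "\<lambda>y. x \<otimes> y"])
     (use assms in \<open>auto simp: m_assoc[symmetric]\<close>)

lemma (in group) ring_group_ring: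
  assumes fin: "finite (carrier G)"
  shows "ring (group_ring G)"
proof -
  have ab: "abelian_group (group_ring G)"
  proof (rule abelian_groupI)
    fix x assume "x \<in> carrier (group_ring G)"
    then show "\<exists>y\<in>carrier (group_ring G). y \<oplus>\<^bsub>group_ring G\<^esub> x = \<zero>\<^bsub>group_ring G\<^esub>"
      by (intro bexI[of _ "\<lambda>g. - x g"]) (auto simp: group_ring_def)
  qed (auto simp: group_ring_def)
  have mon: "monoid (group_ring G)"
  proof (rule monoidI)
    fix a b c :: "'a \<Rightarrow> int"
    show "a \<otimes>\<^bsub>group_ring G\<^esub> b \<otimes>\<^bsub>group_ring G\<^esub> c
        = a \<otimes>\<^bsub>group_ring G\<^esub> (b \<otimes>\<^bsub>group_ring G\<^esub> c)"
    proof
      fix g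
      show "(a \<otimes>\<^bsub>group_ring G\<^esub> b \<otimes>\<^bsub>group_ring G\<^esub> c) g
          = (a \<otimes>\<^bsub>group_ring G\<^esub> (b \<otimes>\<^bsub>group_ring G\<^esub> c)) g"
      proof (cases "g \<in> carrier G")
        case True
        have "(\<Sum>x\<in>carrier G. (\<Sum>y\<in>carrier G. a y * b (inv y \<otimes> x)) * c (inv x \<otimes> g))
          = (\<Sum>y\<in>carrier G. a y * (\<Sum>x\<in>carrier G. b (inv y \<otimes> x) * c (inv x \<otimes> g)))"
          unfolding sum_distrib_right sum_distrib_left
          by (subst sum.swap) (simp add: mult.assoc)
        also have "\<dots> = (\<Sum>y\<in>carrier G. a y *
            (\<Sum>x\<in>carrier G. b x * c (inv x \<otimes> (inv y \<otimes> g))))"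
        proof (rule sum.cong[OF refl], rule arg_cong2[where f = "(*)", OF refl])
          fix y assume y: "y \<in> carrier G"
          have "(\<Sum>x\<in>carrier G. b (inv y \<otimes> x) * c (inv x \<otimes> g))
            = (\<Sum>x\<in>carrier G. b (inv y \<otimes> (y \<otimes> x)) * c (inv (y \<otimes> x) \<otimes> g))"
            using sum_translate[OF y, of "\<lambda>x. b (inv y \<otimes> x) * c (inv x \<otimes> g)"] by simp
          also have "\<dots> = (\<Sum>x\<in>carrier G. b x * c (inv x \<otimes> (inv y \<otimes> g)))"
            by (rule sum.cong) (use y True in \<open>auto simp: m_assoc[symmetric] inv_mult_group\<close>)
          finally show "(\<Sum>x\<in>carrier G. b (inv y \<otimes> x) * c (inv x \<otimes> g))
            = (\<Sum>x\<in>carrier G. b x * c (inv x \<otimes> (inv y \<otimes> g)))" .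
        qed
        finally show ?thesis using True by (simp add: group_ring_def)
      qed (simp add: group_ring_def)
    qed
  next
    fix a assume a: "a \<in> carrier (group_ring G)"
    show "\<one>\<^bsub>group_ring G\<^esub> \<otimes>\<^bsub>group_ring G\<^esub> a = a"
      using a fin by (auto simp: group_ring_def fun_eq_iff)
    show "a \<otimes>\<^bsub>group_ring G\<^esub> \<one>\<^bsub>group_ring G\<^esub> = a"
    proof
      fix g
      have "inv x \<otimes> g = \<one> \<longleftrightarrow> x = g" if "x \<in> carrier G" "g \<in> carrier G" for x
        using that by (metis inv_closed inv_equality inv_inv l_inv)
      then have "(\<Sum>x\<in>carrier G. a x * of_bool (inv x \<otimes> g = \<one>)) = a g" if "g \<in> carrier G"
        using that fin by (simp cong: sum.cong)
      then show "(a \<otimes>\<^bsub>group_ring G\<^esub> \<one>\<^bsub>group_ring G\<^esub>) g = a g"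
        using a by (simp add: group_ring_def)
    qed
  qed (auto simp: group_ring_def)
  show ?thesis
    by (rule ringI[OF ab mon])
       (auto simp: group_ring_def fun_eq_iff ring_distribs sum.distrib)
qed

lemma (in group) group_ring_minus:
  assumes "finite (carrier G)" "a \<in> carrier (group_ring G)" "b \<in> carrier (group_ring G)"
  shows "(a \<ominus>\<^bsub>group_ring G\<^esub> b) = (\<lambda>g. a g - b g)"
proof -
  interpret R: ring "group_ring G"
    using assms(1) by (rule ring_group_ring)
  have "\<ominus>\<^bsub>group_ring G\<^esub> b = (\<lambda>g. - b g)"
    by (rule R.minus_equality) (use assms(3) in \<open>auto simp: group_ring_def\<close>)
  then show ?thesis
    by (simp add: a_minus_def) (simp add: group_ring_def)
qed

lemma group_ring_nat_mult: "[n] \<cdot>\<^bsub>group_ring G\<^esub> a = (\<lambda>g. int n * a g)"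
  by (induction n)
     (simp_all add: add_pow_def nat_pow_def group_ring_def fun_eq_iff algebra_simps)

lemma (in group) group_ring_int_mult:
  fixes k :: int
  assumes "finite (carrier G)" "a \<in> carrier (group_ring G)"
  shows "[k] \<cdot>\<^bsub>group_ring G\<^esub> a = (\<lambda>g. k * a g)"
proof (cases "k < 0")
  case True
  interpret R: ring "group_ring G"
    using assms(1) by (rule ring_group_ring)
  have "\<ominus>\<^bsub>group_ring G\<^esub> (\<lambda>g. - k * a g) = (\<lambda>g. k * a g)"
    by (rule R.minus_equality) (use assms(2) in \<open>auto simp: group_ring_def\<close>)
  then show ?thesis
    using True by (simp add: add_pow_int_lt group_ring_nat_mult)
qed (simp add: add_pow_int_ge group_ring_nat_mult)

end

theory Submission
  imports Defs
begin

text \<open>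
  The coefficient of \<open>g\<close> in \<open>D D\<^sup>-\<^sup>1\<close> is \<open>\<bar>D \<inter> gD\<bar>\<close>, so being a difference set is a counting
  condition, visibly invariant under automorphisms and left translations.  A symmetric
  near-factorization equivalent to the given one would thus have a reversible difference set with
  the forbidden parameters as its first component.  The factorization itself is
  \<open>S (G - S\<^sup>-\<^sup>1) = S G - S S\<^sup>-\<^sup>1 = s G - S S\<^sup>-\<^sup>1\<close>.
\<close>

context group
begin

lemma mem_set_inv_iff:
  assumes "A \<subseteq> carrier G" "x \<in> carrier G"
  shows "x \<in> set_inv A \<longleftrightarrow> inv x \<in> A"
  using assms by (force simp: SET_INV_def)

lemma card_set_inv:
  assumes "A \<subseteq> carrier G"
  shows "card (set_inv A) = card A"
proof -
  have "set_inv A = (\<lambda>x. inv x) ` A"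
    by (auto simp: SET_INV_def)
  moreover have "inj_on (\<lambda>x. inv x) A"
    using assms inj_on_subset[OF inv_inj] by simp
  ultimately show ?thesis
    by (simp add: card_image)
qed

text \<open>At \<open>g\<close> the convolution adds up products of two indicators, so it counts the
  factorizations \<open>g = x \<otimes> y\<close> with \<open>x\<close> in \<open>A\<close> and
  \<open>y\<close> in \<open>B\<close>; \<open>y\<close> is determined by \<open>x\<close>.\<close>

lemma set_sum_mult_set_sum:
  assumes "finite (carrier G)" "A \<subseteq> carrier G" "g \<in> carrier G"
  shows "(set_sum A \<otimes>\<^bsub>group_ring G\<^esub> set_sum B) g = int (card {x \<in> A. inv x \<otimes> g \<in> B})"
proof -
  have "(set_sum A \<otimes>\<^bsub>group_ring G\<^esub> set_sum B) g
      = (\<Sum>x\<in>carrier G. of_bool (x \<in> A \<and> inv x \<otimes> g \<in> B))"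
    using assms(3) by (simp add: group_ring_def set_sum_def of_bool_conj)
  also have "\<dots> = int (card (carrier G \<inter> {x. x \<in> A \<and> inv x \<otimes> g \<in> B}))"
    using assms(1) by (simp add: sum_of_bool_eq)
  also have "carrier G \<inter> {x. x \<in> A \<and> inv x \<otimes> g \<in> B} = {x \<in> A. inv x \<otimes> g \<in> B}"
    using assms(2) by auto
  finally show ?thesis .
qed

text \<open>The inverse of \<open>inv x \<otimes> g\<close> is \<open>inv g \<otimes> x\<close>,
  which turns membership in \<open>set_inv D\<close> into membership in \<open>D\<close>.\<close>

lemma set_sum_mult_set_inv:
  assumes "finite (carrier G)" "D \<subseteq> carrier G" "g \<in> carrier G"
  shows "(set_sum D \<otimes>\<^bsub>group_ring G\<^esub> set_sum (set_inv D)) g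
      = int (card {x \<in> D. inv g \<otimes> x \<in> D})"
proof -
  have "inv x \<otimes> g \<in> set_inv D \<longleftrightarrow> inv g \<otimes> x \<in> D" if "x \<in> D" for x
    using that assms by (subst mem_set_inv_iff) (auto simp: inv_mult_group)
  then have "{x \<in> D. inv x \<otimes> g \<in> set_inv D} = {x \<in> D. inv g \<otimes> x \<in> D}"
    by auto
  then show ?thesis
    using set_sum_mult_set_sum[OF assms] by simp
qed

lemma difference_set_iff_card:
  assumes fin: "finite (carrier G)"
  shows "difference_set G v k l D \<longleftrightarrow>
    order G = v \<and> D \<subseteq> carrier G \<and> card D = k \<and>
    (\<forall>g\<in>carrier G. int (card {x \<in> D. inv g \<otimes> x \<in> D}) = (if g = \<one> then int k else l))"
proof -
  let ?P = "set_sum D \<otimes>\<^bsub>group_ring G\<^esub> set_sum (set_inv D)"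
  let ?E = "\<lambda>g. int k * of_bool (g = \<one>) + l * (of_bool (g \<in> carrier G) - of_bool (g = \<one>))"
  have 1: "set_sum (carrier G) \<ominus>\<^bsub>group_ring G\<^esub> set_sum {\<one>}
      = (\<lambda>g. of_bool (g \<in> carrier G) - of_bool (g = \<one>))"
    by (subst group_ring_minus[OF fin]) (auto simp: set_sum_closed, auto simp: set_sum_def)
  have "[l] \<cdot>\<^bsub>group_ring G\<^esub> (set_sum (carrier G) \<ominus>\<^bsub>group_ring G\<^esub> set_sum {\<one>})
      = (\<lambda>g. l * (of_bool (g \<in> carrier G) - of_bool (g = \<one>)))"
    unfolding 1 by (subst group_ring_int_mult[OF fin]) (auto simp: group_ring_def)
  then have rhs: "[k] \<cdot>\<^bsub>group_ring G\<^esub> set_sum {\<one>} \<oplus>\<^bsub>group_ring G\<^esub>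
      [l] \<cdot>\<^bsub>group_ring G\<^esub> (set_sum (carrier G) \<ominus>\<^bsub>group_ring G\<^esub> set_sum {\<one>}) = ?E"
    by (simp add: group_ring_nat_mult) (simp add: group_ring_def set_sum_def)
  \<comment> \<open>Group ring elements are total functions, so their equality also concerns points
    outside the carrier; both sides are 0 there.\<close>
  have "?P g = ?E g" if "g \<notin> carrier G" for g
    using that by (auto simp: group_ring_def)
  then have "?P = ?E \<longleftrightarrow> (\<forall>g\<in>carrier G. ?P g = ?E g)"
    unfolding fun_eq_iff by blast
  \<comment> \<open>The inclusion of \<open>D\<close> is kept as a premise because it is only
    available as a conjunct of the two sides being compared.\<close>
  also have "\<dots> \<longleftrightarrow> (\<forall>g\<in>carrier G. int (card {x \<in> D. inv g \<otimes> x \<in> D}) = (if g = \<one> then int k else l))"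
    if "D \<subseteq> carrier G"
    by (intro ball_cong refl) (auto simp: set_sum_mult_set_inv[OF fin that])
  finally show ?thesis
    unfolding difference_set_def rhs by blast
qed

lemma near_factorization_iff_card:
  assumes fin: "finite (carrier G)"
  shows "near_factorization G s t l (A, B) \<longleftrightarrow>
    0 < l \<and> A \<subseteq> carrier G \<and> B \<subseteq> carrier G \<and> card A = s \<and> card B = t \<and>
    (\<forall>g\<in>carrier G. card {x \<in> A. inv x \<otimes> g \<in> B} = (if g = \<one> then 0 else l))"
proof -
  let ?P = "set_sum A \<otimes>\<^bsub>group_ring G\<^esub> set_sum B"
  let ?E = "\<lambda>g. int l * (of_bool (g \<in> carrier G) - of_bool (g = \<one>))"
  have rhs: "[l] \<cdot>\<^bsub>group_ring G\<^esub> (set_sum (carrier G) \<ominus>\<^bsub>group_ring G\<^esub> set_sum {\<one>}) = ?E"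
    unfolding group_ring_nat_mult
    by (subst group_ring_minus[OF fin]) (auto simp: set_sum_closed, auto simp: set_sum_def)
  have "?P g = ?E g" if "g \<notin> carrier G" for g
    using that by (auto simp: group_ring_def)
  then have "?P = ?E \<longleftrightarrow> (\<forall>g\<in>carrier G. ?P g = ?E g)"
    unfolding fun_eq_iff by blast
  also have "\<dots> \<longleftrightarrow> (\<forall>g\<in>carrier G. card {x \<in> A. inv x \<otimes> g \<in> B} = (if g = \<one> then 0 else l))"
    if "A \<subseteq> carrier G"
    by (intro ball_cong refl) (auto simp: set_sum_mult_set_sum[OF fin that] simp flip: of_nat_eq_iff)
  finally show ?thesis
    unfolding near_factorization_def rhs prod.case by blast
qed

text \<open>The map \<open>y \<mapsto> h \<otimes> f y\<close> carries \<open>D\<close> to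
  \<open>D'\<close> and turns left translation by \<open>c\<close> into left translation by
  \<open>g\<close> when \<open>f c\<close> is the conjugate of \<open>g\<close> by
  \<open>inv h\<close>. Hence the count for \<open>D'\<close> at \<open>g\<close> is the count for
  \<open>D\<close> at \<open>c\<close>.\<close>

lemma difference_set_equivalent:
  assumes fin: "finite (carrier G)"
    and D: "difference_set G v k l D" and eq: "set_equivalent G D D'"
  shows "difference_set G v k l D'"
proof -
  from eq obtain f h where f: "f \<in> auto G" and h: "h \<in> carrier G" and D': "D' = h <# (f ` D)"
    by (auto simp: set_equivalent_def)
  from f have hom: "f \<in> hom G G" and bij: "bij_betw f (carrier G) (carrier G)"
    by (auto simp: auto_def Bij_def)
  interpret f: group_hom G G f
    using hom by unfold_locales
  from D have sub: "D \<subseteq> carrier G" and card: "order G = v" "card D = k"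
    and count: "\<And>g. g \<in> carrier G \<Longrightarrow>
      int (card {x \<in> D. inv g \<otimes> x \<in> D}) = (if g = \<one> then int k else l)"
    by (auto simp: difference_set_iff_card[OF fin])
  let ?m = "\<lambda>y. h \<otimes> f y"
  have img: "D' = ?m ` D"
    by (auto simp: D' l_coset_def)
  have inj: "inj_on ?m (carrier G)"
    using bij h by (auto simp: inj_on_def bij_betw_def)
  have sub': "D' \<subseteq> carrier G"
    using sub h by (auto simp: img)
  have "int (card {x \<in> D'. inv g \<otimes> x \<in> D'}) = (if g = \<one> then int k else l)"
    if g: "g \<in> carrier G" for g
  proof -
    have "inv h \<otimes> g \<otimes> h \<in> f ` carrier G"
      using g h bij by (simp add: bij_betw_def)
    then obtain c where c: "c \<in> carrier G" and fc: "f c = inv h \<otimes> g \<otimes> h"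
      by auto
    have conj: "h \<otimes> f c = g \<otimes> h"
      using g h by (simp add: fc m_assoc[symmetric])
    \<comment> \<open>Ensures that the counts at \<open>c\<close> and at \<open>g\<close> fall into
      the same branch of the case distinction.\<close>
    have c1: "c = \<one> \<longleftrightarrow> g = \<one>"
    proof
      assume "c = \<one>"
      then have "g \<otimes> h = \<one> \<otimes> h"
        using conj h by simp
      then show "g = \<one>"
        using g h by (simp only: right_cancel one_closed)
    next
      assume "g = \<one>"
      then have "f c = f \<one>"
        using fc h by simp
      then show "c = \<one>"
        using bij c by (auto simp: bij_betw_def inj_on_def)
    qed
    have shift: "inv g \<otimes> ?m y = ?m (inv c \<otimes> y)" if y: "y \<in> carrier G" for y
    proof -
      \<comment> \<open>The claim is shown after multiplication by \<open>g\<close>: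
        \<open>conj\<close> replaces \<open>g \<otimes> h\<close> by \<open>h \<otimes> f c\<close>,
        and then \<open>f\<close> is multiplicative.\<close>
      have "g \<otimes> ?m (inv c \<otimes> y) = h \<otimes> f c \<otimes> f (inv c \<otimes> y)"
        unfolding conj using g h c y by (simp add: m_assoc)
      also have "\<dots> = h \<otimes> f (c \<otimes> (inv c \<otimes> y))"
        using h c y by (simp only: f.hom_mult m_assoc f.hom_closed inv_closed m_closed)
      also have "c \<otimes> (inv c \<otimes> y) = y"
        using c y by (simp add: m_assoc[symmetric])
      finally show ?thesis
        using g h c y by (metis inv_solve_left f.hom_closed inv_closed m_closed)
    qed
    have "inv g \<otimes> ?m y \<in> D' \<longleftrightarrow> inv c \<otimes> y \<in> D" if "y \<in> D" for y
    proof -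
      have y: "y \<in> carrier G"
        using that sub by auto
      show ?thesis
        unfolding shift[OF y] img
        by (rule inj_on_image_mem_iff[OF inj _ sub]) (use y c in simp)
    qed
    then have "{x \<in> D'. inv g \<otimes> x \<in> D'} = ?m ` {y \<in> D. inv c \<otimes> y \<in> D}"
      by (auto simp: img)
    moreover have "inj_on ?m {y \<in> D. inv c \<otimes> y \<in> D}"
      using sub by (auto intro: inj_on_subset[OF inj])
    ultimately show ?thesis
      using count[OF c] by (simp add: card_image c1)
  qed
  moreover have "card D' = k"
    using card_image[OF inj_on_subset[OF inj sub]] card by (simp add: img)
  ultimately show ?thesis
    using sub' card by (simp add: difference_set_iff_card[OF fin])
qed

text \<open>Passing to the complement of \<open>set_inv S\<close> removes from \<open>S\<close> the
  elements counted by the difference set property. This leaves \<open>s - s = 0\<close> at the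
  identity and \<open>s - (s - l) = l\<close> elsewhere.\<close>

lemma difference_set_near_factorization:
  assumes fin: "finite (carrier G)" and l: "0 < l"
    and D: "difference_set G (s + t) s (int s - int l) S"
  shows "near_factorization G s t l (S, carrier G - set_inv S)"
proof -
  from D have sub: "S \<subseteq> carrier G" and ord: "order G = s + t" and s: "card S = s"
    and count: "\<And>g. g \<in> carrier G \<Longrightarrow>
      int (card {x \<in> S. inv g \<otimes> x \<in> S}) = (if g = \<one> then int s else int s - int l)"
    by (auto simp: difference_set_iff_card[OF fin])
  have finS: "finite S"
    using fin sub finite_subset by blast
  have inv_sub: "set_inv S \<subseteq> carrier G"
    using sub by (auto simp: SET_INV_def)
  have "card (carrier G - set_inv S) = t"
    using card_Diff_subset[OF finite_subset[OF inv_sub fin] inv_sub] card_set_inv[OF sub] ord s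
    by (simp add: order_def)
  moreover have "card {x \<in> S. inv x \<otimes> g \<in> carrier G - set_inv S} = (if g = \<one> then 0 else l)"
    if g: "g \<in> carrier G" for g
  proof -
    have "inv x \<otimes> g \<in> set_inv S \<longleftrightarrow> inv g \<otimes> x \<in> S" if "x \<in> S" for x
      using that sub g by (subst mem_set_inv_iff) (auto simp: inv_mult_group)
    then have "{x \<in> S. inv x \<otimes> g \<in> carrier G - set_inv S} = S - {x \<in> S. inv g \<otimes> x \<in> S}"
      using sub g by auto
    moreover have "card (S - {x \<in> S. inv g \<otimes> x \<in> S}) = card S - card {x \<in> S. inv g \<otimes> x \<in> S}"
      by (rule card_Diff_subset) (use finS in auto)
    \<comment> \<open>Away from the identity the removed part has \<open>int s - int l\<close>
      elements, so the truncated difference on naturals is exactly \<open>l\<close>.\<close>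
    ultimately show ?thesis
      using count[OF g] s by (auto split: if_splits)
  qed
  ultimately show ?thesis
    using l sub s by (simp add: near_factorization_iff_card[OF fin])
qed

text \<open>The degenerate case \<open>\<lambda> = k\<close>: the set is translation invariant, hence empty or the whole group.\<close>

lemma difference_set_trivial_reversible:
  assumes fin: "finite (carrier G)" and D: "difference_set G v k (int k) D"
  shows "reversible G D"
proof -
  from D have sub: "D \<subseteq> carrier G" and k: "card D = k"
    and count: "\<And>g. g \<in> carrier G \<Longrightarrow> card {x \<in> D. inv g \<otimes> x \<in> D} = k"
    by (auto simp: difference_set_iff_card[OF fin])
  \<comment> \<open>The elements of \<open>D\<close> that stay in \<open>D\<close> form a subset
    with as many elements as the finite set \<open>D\<close>, hence all of \<open>D\<close>.\<close>
  have inv_closed_D: "inv g \<otimes> x \<in> D" if g: "g \<in> carrier G" and x: "x \<in> D" for g x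
  proof -
    have "{x \<in> D. inv g \<otimes> x \<in> D} = D"
      by (rule card_subset_eq) (use fin sub k count[OF g] finite_subset in auto)
    then show ?thesis
      using x by blast
  qed
  have "y \<in> D" if x: "x \<in> D" and y: "y \<in> carrier G" for x y
  proof -
    \<comment> \<open>Left translation is transitive: this choice of \<open>g\<close> takes the
      given \<open>x\<close> in \<open>D\<close> to an arbitrary \<open>y\<close>.\<close>
    have "inv (x \<otimes> inv y) \<otimes> x = y"
      using x y sub by (auto simp: inv_mult_group m_assoc)
    then show ?thesis
      using inv_closed_D[of "x \<otimes> inv y" x] x y sub by auto
  qed
  then have "D = {} \<or> D = carrier G"
    using sub by blast
  moreover have "set_inv (carrier G) = carrier G"
  proof
    show "carrier G \<subseteq> set_inv (carrier G)"
      by (simp add: subset_iff mem_set_inv_iff)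
  qed (auto simp: SET_INV_def)
  moreover have "set_inv {} = {}"
    by (simp add: SET_INV_def)
  ultimately show ?thesis
    unfolding reversible_def by metis
qed

end

theorem theorem2p9:
  fixes G :: "('a, 'b) monoid_scheme" and S :: "'a set" and s t l :: nat
  assumes "group G" and "finite (carrier G)"
    and "difference_set G (s + t) s (int s - int l) S"
    and "\<not> (\<exists>D. difference_set G (s + t) s (int s - int l) D \<and> reversible G D)"
  shows "near_factorization G s t l (S, carrier G - set_inv\<^bsub>G\<^esub> S) \<and>
    \<not> (\<exists>s' t' l' S' T'. near_factorization G s' t' l' (S', T') \<and> symmetric_pair G (S', T') \<and>
          pair_equivalent G (S, carrier G - set_inv\<^bsub>G\<^esub> S) (S', T'))"
proof -
  interpret group G by fact
  \<comment> \<open>A near-factorization requires a positive \<open>l\<close>. For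
    \<open>l = 0\<close> the set \<open>S\<close> would itself be a reversible difference set with
    the excluded parameters.\<close>
  have "l \<noteq> 0"
  proof
    assume "l = 0"
    then have "difference_set G (s + t) s (int s) S"
      using assms(3) by simp
    from difference_set_trivial_reversible[OF assms(2) this] show False
      using assms(3,4) by blast
  qed
  then have "near_factorization G s t l (S, carrier G - set_inv\<^bsub>G\<^esub> S)"
    using difference_set_near_factorization assms(2,3) by blast
  moreover have "\<not> (symmetric_pair G (S', T') \<and>
      pair_equivalent G (S, carrier G - set_inv\<^bsub>G\<^esub> S) (S', T'))" for S' T'
    using difference_set_equivalent[OF assms(2,3)] assms(4)
    unfolding pair_equivalent_def symmetric_pair_def reversible_def prod.case by blast
  ultimately show ?thesis
    by blast
qed

end
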